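(* Let $a\ge 2$ be an integer. Let $a=dy$ be any factorization of $a$ into positive integers, and let $a-1=pz$ be any factorization of $a-1$ into positive integers. Put $x=z+y$, $b=dx$, $c=d+p$, $n=cx$, $m=cy$. Then $b=n-m+1$ and there exists an $(a,b)$-regular bipartite graph of order $(n,m)$.
   Context: All graphs are finite, simple and undirected. A bipartite graph $G=(U,V;E)$ has color classes $U,V$; it is of order $(n,m)$ if $|U|=n$ and $|V|=m$, and it is $(a,b)$-regular if every vertex of $U$ has degree $a$ and every vertex of $V$ has degree $b$. *)

theory Defs
  imports "Graph_Theory.Digraph"
begin

text \<open>
  The locale predicate \<open>Digraph.graph\<close> describes finite simple undirected graphs, encoded as
  finite symmetric digraphs without loops and without parallel arcs: the edge uv is the pair
  of arcs (u,v), (v,u). Hence \<open>out_degree G v\<close> is the number of edges at v.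
\<close>

definition bipartite_graph :: "('a, 'b) pre_digraph \<Rightarrow> 'a set \<Rightarrow> 'a set \<Rightarrow> bool" where
  "bipartite_graph G U V \<longleftrightarrow>
     Digraph.graph G \<and> verts G = U \<union> V \<and> U \<inter> V = {} \<and> arcs_ends G \<subseteq> U \<times> V \<union> V \<times> U"

definition has_order :: "'a set \<Rightarrow> 'a set \<Rightarrow> nat \<Rightarrow> nat \<Rightarrow> bool" where
  "has_order U V n m \<longleftrightarrow> card U = n \<and> card V = m"

definition biregular ::
    "('a, 'b) pre_digraph \<Rightarrow> 'a set \<Rightarrow> 'a set \<Rightarrow> nat \<Rightarrow> nat \<Rightarrow> bool" where
  "biregular G U V a b \<longleftrightarrow>
     (\<forall>u\<in>U. out_degree G u = a) \<and> (\<forall>v\<in>V. out_degree G v = b)"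

end

theory Submission
  imports Defs
begin

text \<open>
  Let \<open>u\<close> and \<open>v\<close>, taken from intervals of lengths \<open>c x\<close> and \<open>c y\<close>, be adjacent iff
  \<open>(u + v) mod c < d\<close>. In every complete residue system modulo \<open>c\<close> each vertex then
  has exactly \<open>d\<close> neighbours, so the degrees are \<open>d y\<close> and \<open>d x\<close>. Using \<open>u + v\<close> in place of the
  difference makes the condition symmetric without subtraction in \<open>\<nat>\<close>.
\<close>

text \<open>Shifting by \<open>s\<close> and reducing modulo \<open>c\<close> maps \<open>c\<close>
  consecutive integers bijectively onto \<open>{..<c}\<close>, so each of the \<open>d\<close>
  residues below \<open>d\<close> is hit exactly once.\<close>

lemma card_residue_block:
  fixes c d k s :: nat
  assumes "d \<le> c"
  shows "card {w \<in> {k..<k + c}. (w + s) mod c < d} = d"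
proof -
  let ?f = "\<lambda>w. (w + s) mod c"
  have inj: "inj_on ?f {k..<k + c}"
  proof (rule linorder_inj_onI')
    fix i j assume *: "i \<in> {k..<k + c}" "j \<in> {k..<k + c}" "i < j"
    show "?f i \<noteq> ?f j"
    proof
      assume "?f i = ?f j"
      \<comment> \<open>The difference is \<open>j - i\<close>, which lies strictly between 0 and
        \<open>c\<close>.\<close>
      then have "c dvd (j + s) - (i + s)"
        using * mod_eq_dvd_iff_nat[where m = "j + s" and n = "i + s" and q = c] by simp
      then show False using * by (auto dest!: dvd_imp_le)
    qed
  qed
  have "?f ` {k..<k + c} = {..<c}"
    by (rule card_subset_eq) (auto simp: card_image[OF inj])
  moreover have "?f ` {w \<in> {k..<k + c}. ?f w < d} = ?f ` {k..<k + c} \<inter> {..<d}"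
    by blast
  ultimately have "?f ` {w \<in> {k..<k + c}. ?f w < d} = {..<d}"
    using assms by auto
  moreover have "inj_on ?f {w \<in> {k..<k + c}. ?f w < d}"
    by (rule inj_on_subset[OF inj]) auto
  ultimately show ?thesis
    using card_image[of ?f "{w \<in> {k..<k + c}. ?f w < d}"] by (simp only: card_lessThan)
qed

text \<open>Induction on \<open>q\<close> splits off the last block of length \<open>c\<close>. That
  block starts at \<open>k + c * q\<close>, which is why the single-block count allows an arbitrary
  start.\<close>

lemma card_residue_blocks:
  fixes c d k q s :: nat
  assumes "d \<le> c"
  shows "card {w \<in> {k..<k + c * q}. (w + s) mod c < d} = d * q"
proof (induction q)
  case (Suc q)
  let ?A = "\<lambda>i j. {w \<in> {i..<j}. (w + s) mod c < d}"
  have "?A k (k + c * Suc q) = ?A k (k + c * q) \<union> ?A (k + c * q) (k + c * q + c)"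
    by auto
  moreover have "?A k (k + c * q) \<inter> ?A (k + c * q) (k + c * q + c) = {}"
    by auto
  ultimately have "card (?A k (k + c * Suc q))
      = card (?A k (k + c * q)) + card (?A (k + c * q) (k + c * q + c))"
    by (simp add: card_Un_disjoint)
  then show ?case
    using Suc.IH card_residue_block[OF assms] by simp
qed simp

definition bipartite_of ::
    "'a set \<Rightarrow> 'a set \<Rightarrow> ('a \<Rightarrow> 'a \<Rightarrow> bool) \<Rightarrow> ('a, 'a \<times> 'a) pre_digraph" where
  "bipartite_of U V R =
     \<lparr>verts = U \<union> V, arcs = {(u, v) \<in> U \<times> V \<union> V \<times> U. R u v}, tail = fst, head = snd\<rparr>"

lemma bipartite_graph_bipartite_of:
  assumes "finite U" "finite V" "U \<inter> V = {}" "symp R"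
  shows "bipartite_graph (bipartite_of U V R) U V"
proof -
  let ?G = "bipartite_of U V R"
  have "finite (arcs ?G)"
    by (rule finite_subset[of _ "U \<times> V \<union> V \<times> U"]) (use assms in \<open>auto simp: bipartite_of_def\<close>)
  moreover have "symmetric ?G"
    using assms(4)
    by (auto simp: symmetric_def sym_def arcs_ends_def arc_to_ends_def bipartite_of_def dest: sympD)
  ultimately have "Digraph.graph ?G"
    using assms
    by unfold_locales (auto simp: bipartite_of_def arc_to_ends_def)
  then show ?thesis
    using assms(3)
    by (auto simp: bipartite_graph_def bipartite_of_def arcs_ends_def arc_to_ends_def)
qed

text \<open>By disjointness no arc of \<open>V \<times> U\<close> starts at \<open>u\<close>, so the
  arcs leaving \<open>u\<close> correspond to its neighbours in \<open>V\<close>.\<close>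

lemma out_degree_bipartite_of_left:
  assumes "U \<inter> V = {}" "u \<in> U"
  shows "out_degree (bipartite_of U V R) u = card {v \<in> V. R u v}"
proof -
  have "out_arcs (bipartite_of U V R) u = Pair u ` {v \<in> V. R u v}"
    using assms by (auto simp: out_arcs_def bipartite_of_def)
  then show ?thesis
    by (simp add: out_degree_def card_image inj_on_def)
qed

lemma bipartite_of_commute: "bipartite_of U V R = bipartite_of V U R"
  by (auto simp: bipartite_of_def)

lemma out_degree_bipartite_of_right:
  assumes "U \<inter> V = {}" "v \<in> V"
  shows "out_degree (bipartite_of U V R) v = card {u \<in> U. R v u}"
  using out_degree_bipartite_of_left[of V U v R] assms
  by (simp add: bipartite_of_commute[of U V] Int_commute)

lemma ex_biregular_bipartite_graph:
  fixes c d x y :: nat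
  assumes "d \<le> c"
  shows "\<exists>(G :: (nat, nat \<times> nat) pre_digraph) U V.
    bipartite_graph G U V \<and> has_order U V (c * x) (c * y) \<and> biregular G U V (d * y) (d * x)"
proof -
  \<comment> \<open>\<open>V\<close> begins where \<open>U\<close> ends, which makes the classes
    disjoint. The summand 0 gives \<open>U\<close> the shape \<open>{k..<k + c * q}\<close> of the
    counting lemma.\<close>
  define U V where "U = {0..<0 + c * x}" and "V = {c * x..<c * x + c * y}"
  let ?R = "\<lambda>u v. (v + u) mod c < d"
  let ?G = "bipartite_of U V ?R"
  have UV: "finite U" "finite V" "U \<inter> V = {}"
    by (auto simp: U_def V_def)
  have "symp ?R"
    by (simp add: symp_def add.commute)
  then have "bipartite_graph ?G U V"
    by (rule bipartite_graph_bipartite_of[OF UV])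
  moreover have "has_order U V (c * x) (c * y)"
    by (simp add: has_order_def U_def V_def)
  moreover have "biregular ?G U V (d * y) (d * x)"
    unfolding biregular_def
  proof (intro conjI ballI)
    fix u assume "u \<in> U"
    show "out_degree ?G u = d * y"
      unfolding out_degree_bipartite_of_left[OF UV(3) \<open>u \<in> U\<close>] unfolding V_def
      by (rule card_residue_blocks[OF assms])
  next
    fix v assume "v \<in> V"
    show "out_degree ?G v = d * x"
      unfolding out_degree_bipartite_of_right[OF UV(3) \<open>v \<in> V\<close>] unfolding U_def
      by (rule card_residue_blocks[OF assms])
  qed
  ultimately show ?thesis by blast
qed

theorem proposition4p8:
  fixes a d y p z x b c n m :: nat
  assumes "a \<ge> 2"
    and "d > 0" and "y > 0" and "a = d * y"
    and "p > 0" and "z > 0" and "a - 1 = p * z"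
    and "x = z + y" and "b = d * x" and "c = d + p" and "n = c * x" and "m = c * y"
  shows "int b = int n - int m + 1 \<and>
    (\<exists>(G :: (nat, nat \<times> nat) pre_digraph) U V.
       bipartite_graph G U V \<and> has_order U V n m \<and> biregular G U V a b)"
proof
  have "d * y = p * z + 1"
    using assms by linarith
  \<comment> \<open>Expanding with \<open>x = z + y\<close>, both sides share
    \<open>d * x + p * y\<close>; what remains is \<open>d * y = p * z + 1\<close>.\<close>
  then have "b + m = n + 1"
    using assms by (simp add: algebra_simps)
  then show "int b = int n - int m + 1"
    by linarith
next
  show "\<exists>(G :: (nat, nat \<times> nat) pre_digraph) U V.
      bipartite_graph G U V \<and> has_order U V n m \<and> biregular G U V a b"
    using ex_biregular_bipartite_graph[of d c x y] assms by simp
qed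

end
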